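(* $$\#\left\{n<N:\ s_2(n^2)=s_2(n)\right\}\gg N^{1/19}.$$
   Context: $s_2(m)$ denotes the sum of the binary digits of the nonnegative integer $m$ (i.e. the number of ones in its binary expansion). $n$ ranges over positive integers. *)

theory Defs
  imports "HOL-Library.Landau_Symbols" "HOL-Analysis.Analysis"
begin

fun s2 :: "nat \<Rightarrow> nat" where
  "s2 m = (if m = 0 then 0 else m mod 2 + s2 (m div 2))"

declare s2.simps [simp del]

lemma s2_eq_card_bits: "s2 m = card {k. bit m k}"
proof (induction m rule: s2.induct)
  case (1 m)
  show ?case
  proof (cases "m = 0")
    case True
    then show ?thesis by (simp add: s2.simps)
  next
    case False
    have fin: "finite {k. bit (m div 2) k}"
    proof (rule finite_subset)
      show "{k. bit (m div 2) k} \<subseteq> {..m}"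
      proof
        fix k assume "k \<in> {k. bit (m div 2) k}"
        then have "m div 2 div 2 ^ k \<noteq> 0" by (metis bit_iff_odd even_zero mem_Collect_eq)
        then have "2 ^ k \<le> m div 2" by (metis div_less not_less)
        moreover have "k < (2::nat) ^ k" by (rule less_exp)
        ultimately have "k \<le> m" by linarith
        then show "k \<in> {..m}" by simp
      qed
    qed simp
    have eq: "{k. bit m k} = (if odd m then {0} else {}) \<union> Suc ` {k. bit (m div 2) k}"
    proof (rule set_eqI)
      fix k
      show "k \<in> {k. bit m k} \<longleftrightarrow> k \<in> (if odd m then {0} else {}) \<union> Suc ` {k. bit (m div 2) k}"
        by (cases k) (auto simp: bit_0 bit_Suc)
    qed
    have "card {k. bit m k} = m mod 2 + card {k. bit (m div 2) k}"
      unfolding eq using fin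
      by (subst card_Un_disjoint) (auto simp: card_image odd_iff_mod_2_eq_one)
    with 1[OF False] False show ?thesis by (simp add: s2.simps[of m])
  qed
qed

end

theory Submission
  imports Defs
begin

text \<open>
  Subtracting a short odd number \<open>u\<close> from \<open>(2^a - 1) * 2^b\<close> makes the cross term of the square
  negative, so that its \<open>a\<close> ones are traded for zeros: for \<open>u \<le> 2^a\<close> and \<open>b\<close> large,
  \<open>n = (2^a - 1) * 2^b - u\<close> satisfies \<open>s2 (n\<^sup>2) - s2 n = s2 (u\<^sup>2) + s2 u - a - 1\<close>, and \<open>a\<close> can be
  chosen to make this vanish as soon as \<open>s2 (u\<^sup>2) + s2 u\<close> exceeds the length of \<open>u\<close>. The latter
  holds for \<open>u = 2^(2t) - v\<close> with \<open>v < 2^t\<close> odd, where \<open>a < 6t\<close> and \<open>b = 8t\<close> will do. This gives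
  \<open>2^(t-1)\<close> solutions below \<open>2^(14t)\<close>, that is, even the exponent \<open>1/14\<close>.
\<close>

lemma s2_0 [simp]: "s2 0 = 0"
  by (simp add: s2.simps)

lemma s2_double [simp]: "s2 (2 * m) = s2 m"
  by (cases "m = 0") (simp_all add: s2.simps[of "2 * m"])

lemma s2_double_Suc [simp]: "s2 (Suc (2 * m)) = Suc (s2 m)"
  by (simp add: s2.simps[of "Suc (2 * m)"])

lemma s2_1 [simp]: "s2 (Suc 0) = Suc 0"
  using s2_double_Suc[of 0] by simp

lemma s2_pos: "m > 0 \<Longrightarrow> s2 m > 0"
proof (induction m rule: less_induct)
  case (less m)
  show ?case
  proof (cases "even m")
    case True
    then obtain k where "m = 2 * k" by blast
    with less show ?thesis by simp
  next
    case False
    then obtain k where "m = Suc (2 * k)" by (metis oddE Suc_eq_plus1)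
    then show ?thesis by simp
  qed
qed

lemma s2_le_length: "m < 2 ^ k \<Longrightarrow> s2 m \<le> k"
proof (induction k arbitrary: m)
  case (Suc k)
  then have "s2 (m div 2) \<le> k" by auto
  then show ?case by (cases "m = 0") (auto simp: s2.simps[of m])
qed simp

lemma s2_append:
  assumes "y < 2 ^ k"
  shows "s2 (2 ^ k * x + y) = s2 x + s2 y"
  using assms
proof (induction k arbitrary: y)
  case (Suc k)
  have IH: "s2 (2 ^ k * x + y div 2) = s2 x + s2 (y div 2)"
    using Suc by auto
  show ?case
  proof (cases "even y")
    case True
    then obtain z where z: "y = 2 * z" by blast
    have "2 ^ Suc k * x + y = 2 * (2 ^ k * x + z)" using z by simp
    then show ?thesis using IH z by (metis s2_double nonzero_mult_div_cancel_left zero_neq_numeral)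
  next
    case False
    then obtain z where z: "y = Suc (2 * z)" by (metis oddE Suc_eq_plus1)
    have "2 ^ Suc k * x + y = Suc (2 * (2 ^ k * x + z))" using z by simp
    moreover have "y div 2 = z" using z by simp
    ultimately show ?thesis using IH z by (metis s2_double_Suc add_Suc_right)
  qed
qed simp

lemma s2_mult_power2: "s2 (2 ^ k * x) = s2 x"
  using s2_append[of 0 k x] by simp

lemma s2_odd: "odd v \<Longrightarrow> s2 v = Suc (s2 (v - 1))"
  by (metis oddE Suc_eq_plus1 diff_Suc_1 s2_double s2_double_Suc)

text \<open>Since \<open>x + y\<close> consists of \<open>k\<close> ones, \<open>x\<close> and
  \<open>y\<close> are bitwise complements within \<open>k\<close> digits.\<close>

lemma s2_complement:
  assumes "x + y + 1 = 2 ^ k"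
  shows "s2 x + s2 y = k"
  using assms
proof (induction k arbitrary: x y)
  case (Suc k)
  have sum: "x + y + 1 = 2 * 2 ^ k" using Suc.prems by simp
  have IH: "s2 (x div 2) + s2 (y div 2) = k"
    by (rule Suc.IH) (use sum in presburger)
  have "x mod 2 + y mod 2 = 1" using sum by presburger
  moreover have "s2 m = m mod 2 + s2 (m div 2)" for m
    by (simp add: s2.simps[of m])
  ultimately show ?case using IH by (metis add.assoc add.left_commute plus_1_eq_Suc)
qed simp

lemma s2_power2_minus:
  assumes "0 < v" "v \<le> 2 ^ k"
  shows "s2 (2 ^ k - v) + s2 (v - 1) = k"
  by (rule s2_complement) (use assms in simp)

text \<open>The product is \<open>2^a * (u - 1) + (2^a - u)\<close>; the low block is the
  \<open>a\<close>-digit complement of \<open>u - 1\<close>, so the dependence on \<open>u\<close>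
  cancels.\<close>

lemma s2_mult_mersenne:
  assumes "0 < u" "u \<le> 2 ^ a"
  shows "s2 (u * (2 ^ a - 1)) = a"
proof -
  obtain w where w: "u = Suc w" using assms by (cases u) auto
  have "u * (2 ^ a - 1) = 2 ^ a * w + (2 ^ a - u)"
    using assms w by (simp add: algebra_simps diff_mult_distrib2)
  moreover have "2 ^ a - u < 2 ^ a" using assms by simp
  ultimately have "s2 (u * (2 ^ a - 1)) = s2 w + s2 (2 ^ a - u)"
    by (simp only: s2_append)
  then show ?thesis
    using s2_power2_minus[OF assms] w by simp
qed

text \<open>In \<open>(2^a - 1)^2 = 2^a * (2^a - 2) + 1\<close> the final 1, shifted by
  \<open>2 * b + 2\<close>, absorbs the negative cross term and leaves \<open>2^(b + 2) * M\<close>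
  with \<open>M = 2^b - u * (2^a - 1)\<close>. So \<open>n^2\<close> splits into three blocks whose
  digits do not overlap.\<close>

lemma s2_mersenne_shift_minus:
  assumes u: "odd u" "u \<le> 2 ^ a" and a: "0 < a"
    and b: "u * (2 ^ a - 1) \<le> 2 ^ b" "u\<^sup>2 < 2 ^ (b + 2)"
  defines "n \<equiv> (2 ^ a - 1) * 2 ^ (b + 1) - u"
  shows "s2 n + s2 u = a + b + 1" and "s2 (n\<^sup>2) = b + s2 (u\<^sup>2)"
proof -
  define A where "A = (2::nat) ^ a - 2"
  have "(2::nat) ^ 1 \<le> 2 ^ a" using a by (intro power_increasing) auto
  then have A: "2 ^ a = A + 2" by (simp add: A_def)
  have "s2 A + s2 (2 - 1) = a"
    unfolding A_def using A by (intro s2_power2_minus) auto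
  then have sA: "s2 A + 1 = a" by simp
  have upos: "0 < u" using u by (auto intro: odd_pos)
  define M where "M = 2 ^ b - u * (A + 1)"
  have M: "M + u * (A + 1) = 2 ^ b" using b(1) A by (simp add: M_def)
  have "u \<le> u * (A + 1)" by simp
  then have uB: "u \<le> 2 ^ b" using M by linarith
  \<comment> \<open>Subtracting \<open>u\<close> borrows one unit of \<open>2^(b + 1)\<close> from
    \<open>2^a - 1 = A + 1\<close>.\<close>
  define C where "C = 2 ^ (b + 1) - u"
  have C: "C + u = 2 ^ (b + 1)" using uB by (simp add: C_def)
  have n: "n = 2 ^ (b + 1) * A + C"
    using C uB unfolding n_def A C_def by (simp add: algebra_simps)
  have sC: "s2 C + s2 u = b + 2"
    using s2_power2_minus[of u "b + 1"] uB upos s2_odd[OF u(1)] by (simp add: C_def)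
  have "C < 2 ^ (b + 1)" using C upos by linarith
  then have "s2 n = s2 A + s2 C" unfolding n by (rule s2_append)
  then show "s2 n + s2 u = a + b + 1" using sA sC by simp

  \<comment> \<open>\<open>M\<close> is the \<open>b\<close>-digit complement of
    \<open>u * (A + 1) - 1\<close>, which has only \<open>a - 1\<close> ones because
    \<open>u * (A + 1)\<close> is odd with \<open>a\<close> ones.\<close>
  have sM: "s2 M + a = b + 1"
  proof -
    have pos: "0 < u * (A + 1)" using upos by simp
    have "odd (u * (A + 1))" using u(1) A a
      by (metis One_nat_def add_2_eq_Suc' add_Suc_right even_Suc even_add even_mult_iff even_numeral even_power add.right_neutral)
    then have "s2 (u * (A + 1)) = Suc (s2 (u * (A + 1) - 1))" by (rule s2_odd)
    moreover have "s2 (u * (A + 1)) = a"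
      using s2_mult_mersenne[OF upos u(2)] A by simp
    moreover have "s2 M + s2 (u * (A + 1) - 1) = b"
      unfolding M_def by (rule s2_power2_minus) (use pos M in auto)
    ultimately show ?thesis by simp
  qed
  define P where "P = (2::nat) ^ b"
  \<comment> \<open>Over the integers no subtraction truncates, so the block form of
    \<open>n^2\<close> is a polynomial identity.\<close>
  have iC: "int C = 2 * int P - int u"
    using arg_cong[OF C, of int] by (simp add: P_def)
  have iM: "int M = int P - int u * (int A + 1)"
    using arg_cong[OF M, of int] by (simp add: P_def algebra_simps)
  have "int (n\<^sup>2) = (2 * int P * int A + int C)\<^sup>2" by (simp add: n P_def)
  also have "\<dots> = 2 * int P * (2 * int P) * ((int A + 2) * int A) + (4 * int P * int M + (int u)\<^sup>2)"
    unfolding iC iM by (simp add: power2_eq_square algebra_simps)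
  also have "\<dots> = int (2 * P * (2 * P) * ((A + 2) * A) + (4 * P * M + u\<^sup>2))"
    by (simp only: of_nat_add of_nat_mult of_nat_power of_nat_numeral)
  finally have "n\<^sup>2 = 2 * P * (2 * P) * ((A + 2) * A) + (4 * P * M + u\<^sup>2)"
    by (simp only: of_nat_eq_iff)
  moreover have "2 * P * (2 * P) = 2 ^ (2 * b + 2)" and "4 * P = 2 ^ (b + 2)"
    by (simp_all add: P_def power_add mult_2 distrib_left distrib_right)
  ultimately have n2: "n\<^sup>2 = 2 ^ (2 * b + 2) * (2 ^ a * A) + (2 ^ (b + 2) * M + u\<^sup>2)"
    by (simp only: A)
  \<comment> \<open>The two lower blocks stay below \<open>2^(2 * b + 2)\<close>, so nothing carries
    into the top one.\<close>
  have "M + 1 \<le> 2 ^ b" using M upos by simp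
  then have "2 ^ (b + 2) * (M + 1) \<le> 2 ^ (b + 2) * (2::nat) ^ b" by (rule mult_le_mono2)
  also have "\<dots> = 2 ^ (2 * b + 2)" by (subst power_add[symmetric]) (rule arg_cong[where f = "(^) 2"], simp)
  finally have "2 ^ (b + 2) * M + u\<^sup>2 < 2 ^ (2 * b + 2)"
    using b(2) by (simp only: distrib_left mult_1_right)
  then have "s2 (n\<^sup>2) = s2 A + (s2 M + s2 (u\<^sup>2))"
    unfolding n2 by (simp only: s2_append[OF b(2)] s2_append s2_mult_power2)
  then show "s2 (n\<^sup>2) = b + s2 (u\<^sup>2)" using sA sM by simp
qed

text \<open>The square is \<open>2^(k + 2) * (2^k - v) + v^2\<close>, and \<open>v^2\<close> fits
  below the shift. The complement \<open>2^k - v\<close> of a short \<open>v\<close> supplies many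
  ones.\<close>

lemma s2_power2_minus_square:
  assumes v: "0 < v" "v \<le> 2 ^ k" "v\<^sup>2 < 2 ^ (k + 2)"
  shows "s2 ((2 ^ (k + 1) - v)\<^sup>2) + s2 (v - 1) = k + s2 (v\<^sup>2)"
proof -
  define M where "M = 2 ^ k - v"
  have M: "2 ^ k = M + v" using v by (simp add: M_def)
  have e: "2 ^ (k + 1) - v = 2 * M + v" using M by simp
  have "(2 * M + v)\<^sup>2 = 4 * (M + v) * M + v\<^sup>2"
    by (simp add: power2_eq_square algebra_simps)
  then have "(2 ^ (k + 1) - v)\<^sup>2 = 2 ^ (k + 2) * M + v\<^sup>2"
    unfolding e by (simp add: M power_add)
  then have "s2 ((2 ^ (k + 1) - v)\<^sup>2) = s2 M + s2 (v\<^sup>2)"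
    using s2_append[OF v(3)] by simp
  then show ?thesis using s2_power2_minus[OF v(1,2)] by (simp add: M_def)
qed

lemma ex_s2_square_eq:
  assumes v: "odd v" "v < 2 ^ t"
  obtains a where "0 < a" "a < 6 * t"
    "s2 (((2 ^ a - 1) * 2 ^ (8 * t) - (2 ^ (2 * t) - v))\<^sup>2)
      = s2 ((2 ^ a - 1) * 2 ^ (8 * t) - (2 ^ (2 * t) - v))"
proof -
  have vpos: "0 < v" using v by (auto intro: odd_pos)
  have t: "0 < t" using v by (cases t) auto
  then obtain k where k: "2 * t = k + 1" and k2: "t \<le> k"
    by (cases "2 * t") auto
  have "(2::nat) ^ t \<le> 2 ^ k" using k2 by (intro power_increasing) auto
  then have vk: "v \<le> 2 ^ k" using v by linarith
  have "v\<^sup>2 < (2 ^ t)\<^sup>2" using v by (intro power_strict_mono) auto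
  then have v2: "v\<^sup>2 < 2 ^ (2 * t)" by (simp add: mult.commute flip: power_mult)
  also have "(2::nat) ^ (2 * t) \<le> 2 ^ (k + 2)" unfolding k by simp
  finally have v2k: "v\<^sup>2 < 2 ^ (k + 2)" .
  define u where "u = 2 ^ (2 * t) - v"
  have vt: "v < 2 ^ (2 * t)" using vk vpos by (simp add: k)
  have upos: "0 < u" and ult: "u < 2 ^ (2 * t)" using vt vpos by (auto simp: u_def)
  have uodd: "odd u" using v(1) vt t by (simp add: u_def)
  have "s2 v \<le> t" by (rule s2_le_length[OF v(2)])
  moreover have "s2 v = Suc (s2 (v - 1))" by (rule s2_odd[OF v(1)])
  moreover have "s2 (v\<^sup>2) \<le> 2 * t" by (rule s2_le_length[OF v2])
  moreover have "0 < s2 (v\<^sup>2)" by (rule s2_pos) (use vpos in simp)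
  moreover have "s2 (u\<^sup>2) + s2 (v - 1) = k + s2 (v\<^sup>2)"
    unfolding u_def k by (rule s2_power2_minus_square[OF vpos vk v2k])
  moreover have "s2 u + s2 (v - 1) = 2 * t"
    unfolding u_def using vpos vt by (intro s2_power2_minus) auto
  \<comment> \<open>With \<open>k = 2 * t - 1\<close> the sum equals
    \<open>4 * t - 1 + s2 (v^2) - 2 * s2 (v - 1)\<close>; both bounds follow from
    \<open>s2 (v - 1) \<le> t - 1\<close> and \<open>1 \<le> s2 (v^2) \<le> 2 * t\<close>.\<close>
  ultimately have S: "2 * t + 1 < s2 (u\<^sup>2) + s2 u" "s2 (u\<^sup>2) + s2 u \<le> 6 * t"
    using k by linarith+
  define a where "a = s2 (u\<^sup>2) + s2 u - 1"
  have a: "a + 1 = s2 (u\<^sup>2) + s2 u" "2 * t < a" "a < 6 * t"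
    using S by (auto simp: a_def)
  obtain b where b: "8 * t = b + 1" using t by (cases "8 * t") auto
  have "(2::nat) ^ (2 * t) \<le> 2 ^ a" using a by (intro power_increasing) auto
  then have ua: "u \<le> 2 ^ a" using ult by linarith
  \<comment> \<open>The shift \<open>8 * t\<close> is chosen for this bound:
    \<open>2 * t + a \<le> 8 * t - 1 = b\<close>.\<close>
  have "u * (2 ^ a - 1) \<le> 2 ^ (2 * t) * 2 ^ a" using ult by (intro mult_mono) auto
  also have "\<dots> \<le> 2 ^ b" unfolding power_add[symmetric] using a(3) b
    by (intro power_increasing) auto
  finally have b1: "u * (2 ^ a - 1) \<le> 2 ^ b" .
  have "u\<^sup>2 < (2 ^ (2 * t))\<^sup>2" using ult by (intro power_strict_mono) auto
  also have "\<dots> = 2 ^ (4 * t)" by (simp flip: power_mult)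
  also have "(2::nat) ^ (4 * t) \<le> 2 ^ (b + 2)" using b by (intro power_increasing) auto
  finally have b2: "u\<^sup>2 < 2 ^ (b + 2)" .
  have "0 < a" using a by simp
  note main = s2_mersenne_shift_minus[OF uodd ua this b1 b2]
  show thesis
  proof (rule that)
    show "s2 (((2 ^ a - 1) * 2 ^ (8 * t) - (2 ^ (2 * t) - v))\<^sup>2)
      = s2 ((2 ^ a - 1) * 2 ^ (8 * t) - (2 ^ (2 * t) - v))"
      unfolding b u_def[symmetric] using main a(1) by linarith
  qed (use a in auto)
qed

text \<open>Each of the \<open>2^(t - 1)\<close> odd \<open>v < 2^t\<close> yields its own solution,
  whence the factor 2; the summand 1 covers \<open>t = 0\<close>.\<close>

lemma card_s2_square_eq_ge:
  assumes "2 ^ (14 * t) \<le> N"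
  shows "2 ^ t \<le> 2 * card {n::nat. 0 < n \<and> n < N \<and> s2 (n\<^sup>2) = s2 n} + 1"
    (is "_ \<le> 2 * card ?S + 1")
proof (cases t)
  case (Suc r)
  define V where "V = (\<lambda>i::nat. Suc (2 * i)) ` {..<2 ^ r}"
  have cardV: "card V = 2 ^ r"
    unfolding V_def by (subst card_image) (auto intro: inj_onI)
  have V: "odd v" "v < 2 ^ t" if "v \<in> V" for v
    using that Suc by (auto simp: V_def)
  have "\<forall>v. \<exists>a. v \<in> V \<longrightarrow> 0 < a \<and> a < 6 * t \<and>
    s2 (((2 ^ a - 1) * 2 ^ (8 * t) - (2 ^ (2 * t) - v))\<^sup>2)
      = s2 ((2 ^ a - 1) * 2 ^ (8 * t) - (2 ^ (2 * t) - v))"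
    using ex_s2_square_eq V by metis
  then obtain a where a: "\<And>v. v \<in> V \<Longrightarrow> 0 < a v \<and> a v < 6 * t \<and>
    s2 (((2 ^ a v - 1) * 2 ^ (8 * t) - (2 ^ (2 * t) - v))\<^sup>2)
      = s2 ((2 ^ a v - 1) * 2 ^ (8 * t) - (2 ^ (2 * t) - v))"
    by metis
  define f where "f v = (2 ^ a v - 1) * 2 ^ (8 * t) - (2 ^ (2 * t) - v)" for v
  have lt: "(2::nat) ^ (2 * t) < 2 ^ (8 * t)" using Suc by (intro power_strict_increasing) auto
  have le: "(2::nat) ^ t \<le> 2 ^ (2 * t)" by (intro power_increasing) auto
  have f_plus: "f v + 2 ^ (2 * t) = (2 ^ a v - 1) * 2 ^ (8 * t) + v"
    and f_pos: "0 < f v" and f_less: "f v < N" if v: "v \<in> V" for v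
  proof -
    have "(2::nat) ^ 1 \<le> 2 ^ a v" using a[OF v] by (intro power_increasing) auto
    then have "1 * 2 ^ (8 * t) \<le> (2 ^ a v - 1) * (2::nat) ^ (8 * t)" by (intro mult_mono) auto
    then show fp: "f v + 2 ^ (2 * t) = (2 ^ a v - 1) * 2 ^ (8 * t) + v" and "0 < f v"
      using lt le V(2)[OF v] unfolding f_def by linarith+
    have "f v \<le> (2 ^ a v - 1) * 2 ^ (8 * t)" by (simp add: f_def)
    also have "\<dots> < 2 ^ a v * 2 ^ (8 * t)" by simp
    also have "\<dots> \<le> 2 ^ (14 * t)" unfolding power_add[symmetric] using a[OF v]
      by (intro power_increasing) auto
    finally show "f v < N" using assms by linarith
  qed
  \<comment> \<open>Although \<open>a v\<close> varies with \<open>v\<close>, it only affects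
    multiples of \<open>2^(8 * t)\<close>, so \<open>v\<close> can be read off modulo that
    power.\<close>
  have "inj_on f V"
  proof (rule inj_on_inverseI)
    fix v assume v: "v \<in> V"
    have "v < 2 ^ (8 * t)" using V[OF v] le lt by linarith
    then show "(f v + 2 ^ (2 * t)) mod 2 ^ (8 * t) = v" by (simp add: f_plus[OF v])
  qed
  then have "card V = card (f ` V)" by (simp add: card_image)
  also have "\<dots> \<le> card ?S"
    by (rule card_mono) (use a f_pos f_less in \<open>auto simp: f_def\<close>)
  finally show ?thesis using cardV Suc by simp
qed simp

theorem theorem1p2:
  shows "(\<lambda>N::nat. real (card {n::nat. 0 < n \<and> n < N \<and> s2 (n ^ 2) = s2 n}))
           \<in> \<Omega>(\<lambda>N. real N powr (1 / 19))"
proof (rule landau_omega.bigI)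
  \<comment> \<open>The constant combines \<open>2^t \<le> 4 * card\<close> with
    \<open>N powr (1 / 14) \<le> 2 * 2^t\<close>, where \<open>2^(14 * t)\<close> is the largest
    power of \<open>2^14\<close> up to \<open>N\<close>.\<close>
  show "0 < (1 / 8 :: real)" by simp
  show "\<forall>\<^sub>F N in sequentially. norm (real (card {n::nat. 0 < n \<and> n < N \<and> s2 (n ^ 2) = s2 n}))
      \<ge> 1 / 8 * norm (real N powr (1 / 19))"
    using eventually_ge_at_top[of "2 ^ 14"]
  proof eventually_elim
    case (elim N)
    have "\<exists>t. (2 ^ 14) ^ t \<le> N \<and> N < (2 ^ 14) ^ (t + 1)"
      by (rule ex_power_ivl1) (use elim in auto)
    then obtain t where t: "2 ^ (14 * t) \<le> N" "N < 2 ^ (14 * (t + 1))"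
      unfolding power_mult by blast
    have "t \<noteq> 0" using t(2) elim by (intro notI) simp
    \<comment> \<open>From \<open>2^t \<ge> 2\<close> the summand 1 in the counting bound is at most
      half of \<open>2^t\<close>; the threshold \<open>2^14\<close> on \<open>N\<close> ensures
      this.\<close>
    then have "(2::nat) \<le> 2 ^ t" by (cases t) auto
    then have c: "2 ^ t \<le> 4 * card {n::nat. 0 < n \<and> n < N \<and> s2 (n ^ 2) = s2 n}"
      using card_s2_square_eq_ge[OF t(1)] by linarith
    have "real N powr (1 / 19) \<le> real N powr (1 / 14)"
      using elim by (intro powr_mono) auto
    also have "\<dots> \<le> real (2 ^ (14 * (t + 1))) powr (1 / 14)"
      using t(2) by (intro powr_mono2) (auto simp: less_imp_le simp del: of_nat_power)
    also have "\<dots> = 2 powr (real (14 * (t + 1)) * (1 / 14))"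
      by (simp add: powr_powr flip: powr_realpow)
    also have "real (14 * (t + 1)) * (1 / 14) = real (t + 1)" by simp
    also have "2 powr real (t + 1) = 2 * real (2 ^ t)" by (subst powr_realpow) auto
    also have "\<dots> \<le> 2 * real (4 * card {n::nat. 0 < n \<and> n < N \<and> s2 (n ^ 2) = s2 n})"
      using c by (intro mult_left_mono) (auto simp only: of_nat_le_iff)
    finally show ?case by simp
  qed
qed

end
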